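(* Let $n\ge2$, $N\ge1$ and $\lambda\in\Delta^N$. The map $\mathcal I_\lambda:T^N_\lambda\to\mathfrak{Ctab}(D^N_\lambda)$, $$\mathcal I_\lambda(\mu_1,\dots,\mu_N)=\Big(\mathcal K_1(\mu_1),\mathcal K_2(\mu_1+\mu_2),\dots,\mathcal K_i\big(\textstyle\sum_{j=1}^i\mu_j\big),\dots,\mathcal K_N(\lambda)\Big),$$ is a bijection.
   Context: Weights of $\mathfrak o_{2n}(\mathbb C)$ are $n$-tuples in the standard basis; $P_+$ is the set of dominant integral weights: $n$-tuples with all entries in $\mathbb Z$ or all in $\frac12+\mathbb Z$ and $\lambda_1\ge\dots\ge\lambda_{n-1}\ge|\lambda_n|$. $P[S]=\{(\pm\frac12,\dots,\pm\frac12)\}$. $T^N$ is the set of $(\mu_1,\dots,\mu_N)\in P[S]^N$ with $\mu_1=(\frac12,\dots,\frac12,\pm\frac12)$ and $\sum_{i\le k}\mu_i\in P_+$ for all $k\le N$; $T^N_\lambda$ is the subset with $\sum_{i=1}^N\mu_i=\lambda$; $\Delta^N=\{\lambda:T^N_\lambda\ne\emptyset\}$. $\mathfrak D(N,n)$ is the set of regular cell diagrams $D(\mathbf l,\mathbf r)$ of length $N$ and height $n$, i.e. pairs of $n$-tuples of non-negative integers with $r_i+l_i=N$ for all $i$, $r_1\ge\dots\ge r_n$, $r_{n-1}\ge l_n$. For $\lambda\in\Delta^N$, $\mathcal K_N(\lambda)=D^N_\lambda\in\mathfrak D(N,n)$ is the diagram with $r_i=\frac N2+\lambda_i$, $l_i=\frac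 N2-\lambda_i$. A diagram $D(\mathbf l^{(1)},\mathbf r^{(1)})\in\mathfrak D(N_1,n)$ contains $D(\mathbf l^{(2)},\mathbf r^{(2)})\in\mathfrak D(N_2,n)$ if $l_i^{(1)}\ge l_i^{(2)}$ and $r_i^{(1)}\ge r_i^{(2)}$ for all $i$. A regular cell table of shape $D^{(N)}\in\mathfrak D(N,n)$ is a sequence $(D^{(1)},\dots,D^{(N)})$ with $D^{(i)}\in\mathfrak D(i,n)$ and $D^{(i)}\supset D^{(j)}$ for $i\ge j$; $\mathfrak{Ctab}(D^{(N)})$ is the set of these. *)

theory Defs
  imports Complex_Main "HOL-Library.FuncSet"
begin

text \<open>
  An \<open>n\<close>-tuple is a function on \<open>{1..n}\<close> that is \<open>undefined\<close> outside it (\<open>\<rightarrow>\<^sub>E\<close>), so that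
  equality of tuples is equality of functions and indices start at 1. Sequences of length
  \<open>N\<close> are encoded in the same way.
\<close>

type_synonym weight = "nat \<Rightarrow> real"

definition dominant_weights :: "nat \<Rightarrow> weight set" where
  "dominant_weights n =
    {lam \<in> {1..n} \<rightarrow>\<^sub>E UNIV.
      ((\<forall>i\<in>{1..n}. lam i \<in> \<int>) \<or> (\<forall>i\<in>{1..n}. lam i - 1/2 \<in> \<int>)) \<and>
      (\<forall>i\<in>{1..<n-1}. lam i \<ge> lam (i + 1)) \<and>
      lam (n - 1) \<ge> \<bar>lam n\<bar>}"

definition spin_weights :: "nat \<Rightarrow> weight set" where
  "spin_weights n = {1..n} \<rightarrow>\<^sub>E {1/2, -1/2}"

definition partial_sum :: "nat \<Rightarrow> (nat \<Rightarrow> weight) \<Rightarrow> nat \<Rightarrow> weight" where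
  "partial_sum n mu k = (\<lambda>i\<in>{1..n}. \<Sum>j=1..k. mu j i)"

text \<open>
  The last entry of \<open>mu 1\<close> is \<open>1/2\<close> or \<open>-1/2\<close> because \<open>mu 1\<close> is a spin weight, so only its
  first \<open>n - 1\<close> entries are constrained explicitly.
\<close>

definition paths :: "nat \<Rightarrow> nat \<Rightarrow> (nat \<Rightarrow> weight) set" where
  "paths n N =
    {mu \<in> {1..N} \<rightarrow>\<^sub>E spin_weights n.
      (\<forall>i\<in>{1..<n}. mu 1 i = 1/2) \<and>
      (\<forall>k\<in>{1..N}. partial_sum n mu k \<in> dominant_weights n)}"

definition paths_to :: "nat \<Rightarrow> nat \<Rightarrow> weight \<Rightarrow> (nat \<Rightarrow> weight) set" where
  "paths_to n N lam = {mu \<in> paths n N. partial_sum n mu N = lam}"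

definition Delta :: "nat \<Rightarrow> nat \<Rightarrow> weight set" where
  "Delta n N = {lam. paths_to n N lam \<noteq> {}}"

text \<open>The pair \<open>(l, r)\<close> stands for the cell diagram $D(\mathbf l, \mathbf r)$.\<close>

type_synonym diagram = "(nat \<Rightarrow> nat) \<times> (nat \<Rightarrow> nat)"

definition regular_diagrams :: "nat \<Rightarrow> nat \<Rightarrow> diagram set" where
  "regular_diagrams N n =
    {(l, r). l \<in> {1..n} \<rightarrow>\<^sub>E UNIV \<and> r \<in> {1..n} \<rightarrow>\<^sub>E UNIV \<and>
      (\<forall>i\<in>{1..n}. r i + l i = N) \<and>
      (\<forall>i\<in>{1..<n}. r i \<ge> r (i + 1)) \<and>
      r (n - 1) \<ge> l n}"

definition diagram_contains :: "nat \<Rightarrow> diagram \<Rightarrow> diagram \<Rightarrow> bool" where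
  "diagram_contains n D1 D2 \<longleftrightarrow>
    (\<forall>i\<in>{1..n}. fst D1 i \<ge> fst D2 i \<and> snd D1 i \<ge> snd D2 i)"

definition cell_tables :: "nat \<Rightarrow> nat \<Rightarrow> diagram \<Rightarrow> (nat \<Rightarrow> diagram) set" where
  "cell_tables N n D =
    {Ds \<in> (\<Pi>\<^sub>E i\<in>{1..N}. regular_diagrams i n).
      (\<forall>i\<in>{1..N}. \<forall>j\<in>{1..N}. i \<ge> j \<longrightarrow> diagram_contains n (Ds i) (Ds j)) \<and>
      Ds N = D}"

text \<open>
  The conversion \<open>nat \<lfloor>_\<rfloor>\<close> only changes the type: on \<open>Delta n N\<close> the entries
  \<open>N/2 \<plusminus> lam i\<close> are non-negative integers, see \<open>weight_diagram_exact\<close> below.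
\<close>

definition weight_diagram :: "nat \<Rightarrow> nat \<Rightarrow> weight \<Rightarrow> diagram" where
  "weight_diagram n N lam =
    ((\<lambda>i\<in>{1..n}. nat \<lfloor>real N / 2 - lam i\<rfloor>), (\<lambda>i\<in>{1..n}. nat \<lfloor>real N / 2 + lam i\<rfloor>))"

lemma weight_diagram_exact:
  assumes "lam \<in> Delta n N" and i: "i \<in> {1..n}"
  shows "real (fst (weight_diagram n N lam) i) = real N / 2 - lam i"
    and "real (snd (weight_diagram n N lam) i) = real N / 2 + lam i"
proof -
  obtain mu where mu: "mu \<in> {1..N} \<rightarrow>\<^sub>E spin_weights n" and lam: "lam = partial_sum n mu N"
    using assms(1) by (auto simp: Delta_def paths_to_def paths_def)
  have pm: "mu j i = 1/2 \<or> mu j i = -1/2" if "j \<in> {1..N}" for j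
    using mu i that unfolding spin_weights_def by (fastforce dest!: PiE_mem)
  have eqs: "real N / 2 - lam i = (\<Sum>j=1..N. 1/2 - mu j i)"
    "real N / 2 + lam i = (\<Sum>j=1..N. 1/2 + mu j i)"
    using i by (simp_all add: lam partial_sum_def sum_subtractf sum.distrib)
  have sum_Nats: "(\<And>j. j \<in> A \<Longrightarrow> f j \<in> \<nat>) \<Longrightarrow> sum f A \<in> \<nat>" for f :: "nat \<Rightarrow> real" and A
    by (induction A rule: infinite_finite_induct) auto
  have "(\<Sum>j=1..N. 1/2 - mu j i) \<in> \<nat>"
    by (intro sum_Nats) (drule pm, elim disjE, simp_all only:, simp_all)
  moreover have "(\<Sum>j=1..N. 1/2 + mu j i) \<in> \<nat>"
    by (intro sum_Nats) (drule pm, elim disjE, simp_all only:, simp_all)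
  ultimately have "real N / 2 - lam i \<in> \<nat>" "real N / 2 + lam i \<in> \<nat>"
    using eqs by simp_all
  then show "real (fst (weight_diagram n N lam) i) = real N / 2 - lam i"
    "real (snd (weight_diagram n N lam) i) = real N / 2 + lam i"
    using i by (auto simp: weight_diagram_def elim!: Nats_cases)
qed

text \<open>On \<open>paths_to n N lam\<close> the last entry is \<open>weight_diagram n N lam\<close>.\<close>

definition path_table :: "nat \<Rightarrow> nat \<Rightarrow> (nat \<Rightarrow> weight) \<Rightarrow> (nat \<Rightarrow> diagram)" where
  "path_table n N mu = (\<lambda>i\<in>{1..N}. weight_diagram n i (partial_sum n mu i))"

end

theory Submission
  imports Defs
begin

text \<open>
  A spin weight adds \<open>\<plusminus>1/2\<close> to each coordinate, so passing from the weight \<open>\<lambda>\<close> after \<open>k\<close> steps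
  to \<open>r = k/2 + \<lambda>\<close>, \<open>l = k/2 - \<lambda>\<close> turns each step into adding exactly one cell, on the right or
  on the left, in every row. Dominance of \<open>\<lambda>\<close> becomes regularity of the diagram. Conversely,
  consecutive nested diagrams have lengths differing by one, so in every row exactly one of
  \<open>l\<close>, \<open>r\<close> grows by one, and the increments of \<open>r\<close> recover the path. The condition on \<open>\<mu>\<^sub>1\<close> is
  automatic: regularity in length one gives \<open>r\<^sub>i \<ge> r\<^bsub>n-1\<^esub> \<ge> max r\<^sub>n (1 - r\<^sub>n) = 1\<close> for \<open>i < n\<close>.
\<close>

text \<open>Regularity compares neighbouring rows only at indices below \<open>n\<close>, so a chain
  of such comparisons is available only on an interval.\<close>

lemma lift_Suc_antimono_le_interval:
  fixes f :: "nat \<Rightarrow> 'a::order"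
  assumes "\<And>i. i \<in> {a..<b} \<Longrightarrow> f (Suc i) \<le> f i" and "a \<le> i" "i \<le> b"
  shows "f b \<le> f i"
  using assms(3,2)
proof (induction i rule: inc_induct)
  case (step j)
  have "f b \<le> f (Suc j)" using step by simp
  also have "\<dots> \<le> f j" using step assms(1) by simp
  finally show ?case .
qed simp

section \<open>From paths to cell tables\<close>

lemma spin_weight_cases:
  assumes "mu \<in> spin_weights n" "i \<in> {1..n}"
  shows "mu i = 1/2 \<or> mu i = -1/2"
  using assms unfolding spin_weights_def by (fastforce dest!: PiE_mem)

lemma partial_sum_extensional: "partial_sum n mu k \<in> extensional {1..n}"
  by (simp add: partial_sum_def)

lemma partial_sum_diff:
  assumes "i \<in> {1..n}" "1 \<le> k"
  shows "partial_sum n mu k i - partial_sum n mu (k - 1) i = mu k i"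
  using assms by (cases k) (simp_all add: partial_sum_def)

text \<open>An initial segment of a path is again a path. This makes
  \<open>weight_diagram_exact\<close> applicable after every step, not only at the endpoint.\<close>

lemma partial_sum_in_Delta:
  assumes mu: "mu \<in> paths n N" and k: "k \<in> {1..N}"
  shows "partial_sum n mu k \<in> Delta n k"
proof -
  \<comment> \<open>Paths of length \<open>k\<close> are undefined beyond \<open>k\<close>, so
    truncation has to be an explicit restriction.\<close>
  let ?nu = "restrict mu {1..k}"
  have ps: "partial_sum n ?nu m = partial_sum n mu m" if "m \<le> k" for m
    unfolding partial_sum_def using that by (intro restrict_ext sum.cong) auto
  have "?nu \<in> {1..k} \<rightarrow>\<^sub>E spin_weights n"
    using mu k by (intro PiE_I) (auto simp: paths_def)
  then have "?nu \<in> paths_to n k (partial_sum n mu k)"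
    using mu k ps by (auto simp: paths_to_def paths_def)
  then show ?thesis by (auto simp: Delta_def)
qed

lemma path_table_exact:
  assumes "mu \<in> paths n N" "k \<in> {1..N}" "i \<in> {1..n}"
  shows "real (fst (path_table n N mu k) i) = real k / 2 - partial_sum n mu k i"
    and "real (snd (path_table n N mu k) i) = real k / 2 + partial_sum n mu k i"
  using assms weight_diagram_exact[OF partial_sum_in_Delta[OF assms(1,2)] assms(3)]
  by (simp_all add: path_table_def)

text \<open>Adding \<open>k/2\<close> preserves the order of the entries, and
  \<open>r (n - 1) \<ge> l n\<close> amounts to \<open>lam (n - 1) \<ge> - lam n\<close>.\<close>

lemma weight_diagram_regular:
  assumes n: "n \<ge> 2" and D: "lam \<in> Delta n k" and dom: "lam \<in> dominant_weights n"
  shows "weight_diagram n k lam \<in> regular_diagrams k n"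
proof -
  obtain l r where lr: "weight_diagram n k lam = (l, r)" by force
  have l: "real (l i) = real k / 2 - lam i" and r: "real (r i) = real k / 2 + lam i"
    if "i \<in> {1..n}" for i
    using weight_diagram_exact[OF D that] by (simp_all add: lr)
  have mono: "lam i \<ge> lam (i + 1)" if "i \<in> {1..<n-1}" for i
    using dom that by (auto simp: dominant_weights_def)
  have last: "lam (n - 1) \<ge> \<bar>lam n\<bar>"
    using dom by (auto simp: dominant_weights_def)
  have "l \<in> {1..n} \<rightarrow>\<^sub>E UNIV" "r \<in> {1..n} \<rightarrow>\<^sub>E UNIV"
    using lr by (auto simp: weight_diagram_def)
  moreover have "r i + l i = k" if "i \<in> {1..n}" for i
    using l[OF that] r[OF that] by linarith
  moreover have "r i \<ge> r (i + 1)" if i: "i \<in> {1..<n}" for i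
  proof -
    have "lam i \<ge> lam (i + 1)"
    \<comment> \<open>The chain in \<open>dominant_weights\<close> stops one index earlier; the
      comparison of the last two entries is half of the absolute value condition.\<close>
    proof (cases "i = n - 1")
      case True
      then show ?thesis using last n by simp
    next
      case False
      then show ?thesis using mono i by force
    qed
    then show ?thesis using r[of i] r[of "i + 1"] i by simp
  qed
  moreover have "r (n - 1) \<ge> l n"
  proof -
    have "n - 1 \<in> {1..n}" "n \<in> {1..n}" using n by auto
    from r[OF this(1)] l[OF this(2)] last show ?thesis by linarith
  qed
  ultimately show ?thesis by (simp add: lr regular_diagrams_def)
qed

text \<open>Each step changes \<open>k/2\<close> by 1/2 and the weight by 1/2 or -1/2, so each of
  \<open>l\<close> and \<open>r\<close> grows by 0 or 1 in every row.\<close>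

lemma path_table_contains_step:
  assumes mu: "mu \<in> paths n N" and k: "k \<in> {1..<N}"
  shows "diagram_contains n (path_table n N mu (Suc k)) (path_table n N mu k)"
  unfolding diagram_contains_def
proof
  fix i assume i: "i \<in> {1..n}"
  have "mu (Suc k) \<in> spin_weights n" using mu k by (auto simp: paths_def)
  then have "mu (Suc k) i = 1/2 \<or> mu (Suc k) i = -1/2"
    using i by (rule spin_weight_cases)
  moreover have "partial_sum n mu (Suc k) i - partial_sum n mu k i = mu (Suc k) i"
    using partial_sum_diff[OF i, of "Suc k" mu] by simp
  moreover have "Suc k \<in> {1..N}" "k \<in> {1..N}" using k by auto
  ultimately show "fst (path_table n N mu k) i \<le> fst (path_table n N mu (Suc k)) i \<and>
      snd (path_table n N mu k) i \<le> snd (path_table n N mu (Suc k)) i"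
    using path_table_exact[OF mu _ i, of k] path_table_exact[OF mu _ i, of "Suc k"]
    by (auto simp: field_simps)
qed

lemma path_table_contains:
  assumes "mu \<in> paths n N" "j \<in> {1..N}" "k \<le> N" "j \<le> k"
  shows "diagram_contains n (path_table n N mu k) (path_table n N mu j)"
  using assms(4,3)
proof (induction k rule: dec_induct)
  case base
  then show ?case by (simp add: diagram_contains_def)
next
  case (step k)
  have "diagram_contains n (path_table n N mu k) (path_table n N mu j)"
    using step by simp
  moreover have "diagram_contains n (path_table n N mu (Suc k)) (path_table n N mu k)"
    using step assms(2) by (intro path_table_contains_step[OF assms(1)]) auto
  ultimately show ?case
    unfolding diagram_contains_def by (meson order_trans)
qed

lemma path_table_in_cell_tables:
  assumes n: "n \<ge> 2" and N: "N \<ge> 1" and mu: "mu \<in> paths_to n N lam"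
  shows "path_table n N mu \<in> cell_tables N n (weight_diagram n N lam)"
proof -
  have mu': "mu \<in> paths n N" and lam: "partial_sum n mu N = lam"
    using mu by (auto simp: paths_to_def)
  have "path_table n N mu \<in> (\<Pi>\<^sub>E i\<in>{1..N}. regular_diagrams i n)"
    unfolding path_table_def restrict_PiE_iff
    using weight_diagram_regular[OF n partial_sum_in_Delta[OF mu']] mu'
    by (auto simp: paths_def)
  moreover have "path_table n N mu N = weight_diagram n N lam"
    using N lam by (simp add: path_table_def)
  ultimately show ?thesis
    using path_table_contains[OF mu'] by (auto simp: cell_tables_def)
qed

section \<open>From cell tables back to paths\<close>

text \<open>A table starts at length 1. The value 0 at \<open>k = 0\<close> supplies the missing
  empty diagram, so that the first step is an increment like the others.\<close>

definition table_row :: "(nat \<Rightarrow> diagram) \<Rightarrow> nat \<Rightarrow> nat \<Rightarrow> real" where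
  "table_row Ds k i = (if k = 0 then 0 else real (snd (Ds k) i))"

definition table_path :: "nat \<Rightarrow> nat \<Rightarrow> (nat \<Rightarrow> diagram) \<Rightarrow> (nat \<Rightarrow> weight)" where
  "table_path n N Ds =
    (\<lambda>j\<in>{1..N}. \<lambda>i\<in>{1..n}. table_row Ds j i - table_row Ds (j - 1) i - 1/2)"

text \<open>The increments of \<open>table_row\<close> telescope, starting from 0.\<close>

lemma partial_sum_table_path:
  assumes "k \<le> N" "i \<in> {1..n}"
  shows "partial_sum n (table_path n N Ds) k i = table_row Ds k i - real k / 2"
  using assms(1)
proof (induction k)
  case 0
  then show ?case using assms(2) by (simp add: partial_sum_def table_row_def)
next
  case (Suc k)
  have "table_path n N Ds (Suc k) i = table_row Ds (Suc k) i - table_row Ds k i - 1/2"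
    using Suc.prems assms(2) by (simp add: table_path_def)
  then show ?case
    using Suc partial_sum_diff[OF assms(2), of "Suc k" "table_path n N Ds"]
    by (simp add: add_divide_distrib)
qed

lemma regular_diagramD:
  assumes "D \<in> regular_diagrams k n"
  shows "fst D \<in> extensional {1..n}" "snd D \<in> extensional {1..n}"
    and "\<And>i. i \<in> {1..n} \<Longrightarrow> snd D i + fst D i = k"
    and "\<And>i. i \<in> {1..<n} \<Longrightarrow> snd D i \<ge> snd D (i + 1)"
    and "snd D (n - 1) \<ge> fst D n"
  using assms by (auto simp: regular_diagrams_def PiE_def)

text \<open>All entries differ from integers by the same \<open>k/2\<close>, so the parity of
  \<open>k\<close> decides between the integral and the half-integral case.\<close>

lemma regular_diagram_dominant:
  assumes n: "n \<ge> 2" and D: "D \<in> regular_diagrams k n"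
    and ext: "lam \<in> extensional {1..n}"
    and lam: "\<And>i. i \<in> {1..n} \<Longrightarrow> lam i = real (snd D i) - real k / 2"
  shows "lam \<in> dominant_weights n"
proof -
  note D = regular_diagramD[OF D]
  have "(\<forall>i\<in>{1..n}. lam i \<in> \<int>) \<or> (\<forall>i\<in>{1..n}. lam i - 1/2 \<in> \<int>)"
  proof (cases "even k")
    case True
    then obtain m where "k = 2 * m" by (elim evenE)
    then show ?thesis by (auto simp: lam)
  next
    case False
    then obtain m where "k = 2 * m + 1" by (elim oddE)
    then have "lam i - 1/2 = real (snd D i) - real m - 1" if "i \<in> {1..n}" for i
      using lam[OF that] by (simp add: field_simps)
    then show ?thesis by simp
  qed
  moreover have "lam i \<ge> lam (i + 1)" if "i \<in> {1..<n}" for i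
    using D(4)[OF that] lam[of i] lam[of "i + 1"] that by simp
  moreover have "lam (n - 1) \<ge> \<bar>lam n\<bar>"
  proof -
    have i: "n - 1 \<in> {1..<n}" "n - 1 \<in> {1..n}" "n \<in> {1..n}" "n - 1 + 1 = n"
      using n by auto
    have "snd D n \<le> snd D (n - 1)" using D(4)[OF i(1)] i(4) by simp
    \<comment> \<open>The bound by \<open>r n\<close> gives \<open>lam (n - 1) \<ge> lam n\<close>;
      the bound by \<open>l n = k - r n\<close> gives
      \<open>lam (n - 1) \<ge> - lam n\<close>.\<close>
    with D(3)[OF i(3)] D(5) lam[OF i(2)] lam[OF i(3)] show ?thesis by linarith
  qed
  ultimately show ?thesis
    using ext by (auto simp: dominant_weights_def PiE_def)
qed

lemma table_path_in_paths:
  assumes n: "n \<ge> 2" and N: "N \<ge> 1" and Ds: "Ds \<in> cell_tables N n D"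
  shows "table_path n N Ds \<in> paths n N"
proof -
  have reg: "Ds k \<in> regular_diagrams k n" if "k \<in> {1..N}" for k
    using Ds that by (auto simp: cell_tables_def)
  have row: "table_row Ds k i - table_row Ds (k - 1) i \<in> {0, 1}"
    if k: "k \<in> {1..N}" and i: "i \<in> {1..n}" for k i
  proof (cases "k = 1")
    case True
    then show ?thesis
      using regular_diagramD(3)[OF reg[OF k] i] by (auto simp: table_row_def)
  next
    case False
    then have k': "k - 1 \<in> {1..N}" using k by auto
    have "diagram_contains n (Ds k) (Ds (k - 1))"
      using Ds k k' by (simp add: cell_tables_def)
    then have "fst (Ds (k - 1)) i \<le> fst (Ds k) i" "snd (Ds (k - 1)) i \<le> snd (Ds k) i"
      using i by (auto simp: diagram_contains_def)
    \<comment> \<open>Neither side shrinks and the row length grows by exactly one, so exactly one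
      side gains a cell.\<close>
    then have "snd (Ds k) i = snd (Ds (k - 1)) i \<or> snd (Ds k) i = snd (Ds (k - 1)) i + 1"
      using regular_diagramD(3)[OF reg[OF k] i] regular_diagramD(3)[OF reg[OF k'] i] k'
      by auto
    then show ?thesis using k' by (auto simp: table_row_def)
  qed
  have "table_path n N Ds \<in> {1..N} \<rightarrow>\<^sub>E spin_weights n"
    unfolding table_path_def spin_weights_def restrict_PiE_iff
  proof (intro ballI)
    fix k i assume "k \<in> {1..N}" "i \<in> {1..n}"
    from row[OF this]
    show "table_row Ds k i - table_row Ds (k - 1) i - 1/2 \<in> {1/2, -1/2}" by auto
  qed
  moreover have "table_path n N Ds 1 i = 1/2" if i: "i \<in> {1..<n}" for i
  proof -
    have one: "1 \<in> {1..N}" using N by simp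
    note R = regular_diagramD[OF reg[OF one]]
    have "snd (Ds 1) (n - 1) \<le> snd (Ds 1) i"
    proof (rule lift_Suc_antimono_le_interval[where a = 1 and f = "snd (Ds 1)"])
      show "snd (Ds 1) (Suc j) \<le> snd (Ds 1) j" if "j \<in> {1..<n - 1}" for j
      proof -
        have "j \<in> {1..<n}" using that by auto
        from R(4)[OF this] show ?thesis by simp
      qed
    qed (use i in auto)
    moreover have "snd (Ds 1) (n - 1) \<ge> 1"
    proof -
      have "n - 1 \<in> {1..<n}" "n \<in> {1..n}" "n - 1 + 1 = n" using n by auto
      with R(3)[of n] R(4)[of "n - 1"] R(5) show ?thesis by simp
    qed
    ultimately have "snd (Ds 1) i = 1" using R(3)[of i] i by auto
    then show ?thesis using i N by (simp add: table_path_def table_row_def)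
  qed
  moreover have "partial_sum n (table_path n N Ds) k \<in> dominant_weights n"
    if k: "k \<in> {1..N}" for k
    using k by (intro regular_diagram_dominant[OF n reg[OF k] partial_sum_extensional])
      (simp add: partial_sum_table_path table_row_def)
  ultimately show ?thesis by (simp add: paths_def)
qed

lemma table_path_in_paths_to:
  assumes n: "n \<ge> 2" and N: "N \<ge> 1" and lam: "lam \<in> Delta n N"
    and Ds: "Ds \<in> cell_tables N n (weight_diagram n N lam)"
  shows "table_path n N Ds \<in> paths_to n N lam"
proof -
  have "lam \<in> extensional {1..n}"
    using lam partial_sum_extensional by (auto simp: Delta_def paths_to_def)
  then have "partial_sum n (table_path n N Ds) N = lam"
  proof (intro extensionalityI[OF partial_sum_extensional])
    fix i assume i: "i \<in> {1..n}"
    have "Ds N = weight_diagram n N lam" using Ds by (simp add: cell_tables_def)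
    then show "partial_sum n (table_path n N Ds) N i = lam i"
      using partial_sum_table_path[OF order.refl i] weight_diagram_exact(2)[OF lam i] N
      by (simp add: table_row_def)
  qed
  then show ?thesis
    using table_path_in_paths[OF n N Ds] by (simp add: paths_to_def)
qed

section \<open>The two maps are mutually inverse\<close>

lemma table_path_path_table:
  assumes mu: "mu \<in> paths n N"
  shows "table_path n N (path_table n N mu) = mu"
proof (rule extensionalityI)
  show "table_path n N (path_table n N mu) \<in> extensional {1..N}"
    by (simp add: table_path_def)
  show "mu \<in> extensional {1..N}" using mu by (auto simp: paths_def PiE_def)
  fix k assume k: "k \<in> {1..N}"
  show "table_path n N (path_table n N mu) k = mu k"
  proof (rule extensionalityI)
    show "table_path n N (path_table n N mu) k \<in> extensional {1..n}"
      using k by (simp add: table_path_def)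
    have "mu k \<in> spin_weights n" using mu k by (auto simp: paths_def)
    then show "mu k \<in> extensional {1..n}" by (simp add: spin_weights_def PiE_def)
    fix i assume i: "i \<in> {1..n}"
    \<comment> \<open>The case \<open>m = 0\<close> is included because \<open>k - 1\<close>
      vanishes at the first step; both sides are then 0.\<close>
    have row: "table_row (path_table n N mu) m i = real m / 2 + partial_sum n mu m i"
      if "m \<le> N" for m
      using path_table_exact(2)[OF mu _ i, of m] that i
      by (cases "m = 0") (auto simp: table_row_def partial_sum_def)
    have "k \<le> N" "k - 1 \<le> N" "1 \<le> k" using k by auto
    with row[of k] row[of "k - 1"] partial_sum_diff[OF i, of k mu]
    show "table_path n N (path_table n N mu) k i = mu k i"
      using k i by (simp add: table_path_def diff_divide_distrib)
  qed
qed

lemma path_table_table_path: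
  assumes n: "n \<ge> 2" and N: "N \<ge> 1" and Ds: "Ds \<in> cell_tables N n D"
  shows "path_table n N (table_path n N Ds) = Ds"
proof (rule extensionalityI)
  show "path_table n N (table_path n N Ds) \<in> extensional {1..N}"
    by (simp add: path_table_def)
  show "Ds \<in> extensional {1..N}" using Ds by (auto simp: cell_tables_def PiE_def)
  fix k assume k: "k \<in> {1..N}"
  have reg: "Ds k \<in> regular_diagrams k n" using Ds k by (auto simp: cell_tables_def)
  let ?D = "path_table n N (table_path n N Ds) k"
  have ext: "fst ?D \<in> extensional {1..n}" "snd ?D \<in> extensional {1..n}"
    using k by (simp_all add: path_table_def weight_diagram_def)
  have eq: "fst ?D i = fst (Ds k) i \<and> snd ?D i = snd (Ds k) i" if i: "i \<in> {1..n}" for i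
  proof -
    have "partial_sum n (table_path n N Ds) k i = real (snd (Ds k) i) - real k / 2"
      using partial_sum_table_path[OF _ i] k by (simp add: table_row_def)
    \<comment> \<open>The path only records \<open>r\<close>; the fixed row length recovers
      \<open>l\<close>.\<close>
    moreover have "real (snd (Ds k) i) + real (fst (Ds k) i) = real k"
      using regular_diagramD(3)[OF reg i] by linarith
    ultimately have "real (fst ?D i) = real (fst (Ds k) i)"
      "real (snd ?D i) = real (snd (Ds k) i)"
      using path_table_exact[OF table_path_in_paths[OF n N Ds] k i] by linarith+
    then show ?thesis by simp
  qed
  show "?D = Ds k"
    using ext regular_diagramD(1,2)[OF reg] eq
    by (intro prod_eqI) (auto intro: extensionalityI)
qed

theorem proposition7p4:
  fixes n N :: nat and lam :: weight
  assumes "n \<ge> 2" and "N \<ge> 1" and "lam \<in> Delta n N"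
  shows "bij_betw (path_table n N) (paths_to n N lam) (cell_tables N n (weight_diagram n N lam))"
proof (rule bij_betw_byWitness[where f' = "table_path n N"])
  show "\<forall>mu\<in>paths_to n N lam. table_path n N (path_table n N mu) = mu"
    using table_path_path_table by (auto simp: paths_to_def)
  show "\<forall>Ds\<in>cell_tables N n (weight_diagram n N lam).
      path_table n N (table_path n N Ds) = Ds"
    using path_table_table_path assms by blast
  show "path_table n N ` paths_to n N lam \<subseteq> cell_tables N n (weight_diagram n N lam)"
    using path_table_in_cell_tables assms by blast
  show "table_path n N ` cell_tables N n (weight_diagram n N lam) \<subseteq> paths_to n N lam"
    using table_path_in_paths_to assms by blast
qed

end
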